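(* For all integers $n,k>0$, $$(-1)^{k} \left( Q_2(n) - \sum_{j=0}^{2k-1} (-1)^{j(j+1)/2}\, pod\big(n-j(j+1)\big) \right) \geqslant 0,$$ with strict inequality if and only if $n\geqslant 2k(2k+1)$.
   Context: A partition of $n$ is a nonincreasing sequence of positive integers (called parts) with sum $n$; the empty partition is the only partition of $0$. $pod(n)$ is the number of partitions of $n$ in which odd parts are distinct and even parts are unrestricted; $pod(0)=1$ and $pod(x)=0$ if $x$ is not a nonnegative integer. $Q_2(n)$ is the number of partitions of $n$ into distinct parts none of which is congruent to $2$ modulo $4$. *)

theory Defs
  imports Complex_Main
begin

definition partitions :: "nat \<Rightarrow> nat list set" where
  "partitions n = {p. sorted_wrt (\<ge>) p \<and> (\<forall>x\<in>set p. 0 < x) \<and> sum_list p = n}"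

(* card would silently be 0 on an infinite set, so finiteness is recorded here. *)
lemma finite_partitions: "finite (partitions n)"
proof (rule finite_subset)
  show "partitions n \<subseteq> {p. set p \<subseteq> {..n} \<and> length p \<le> n}"
  proof
    fix p assume "p \<in> partitions n"
    then have pos: "\<forall>x\<in>set p. 0 < x" and sum: "sum_list p = n"
      by (auto simp: partitions_def)
    have "length p \<le> sum_list p"
      using pos by (induction p) (auto simp: Suc_le_eq)
    moreover have "\<forall>x\<in>set p. x \<le> sum_list p"
      by (simp add: member_le_sum_list)
    ultimately show "p \<in> {p. set p \<subseteq> {..n} \<and> length p \<le> n}"
      using sum by auto
  qed
  show "finite {p. set p \<subseteq> {..n} \<and> length p \<le> n}"
    by (rule finite_lists_length_le) simp
qed

definition pod :: "int \<Rightarrow> nat" where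
  "pod m = (if m < 0 then 0
            else card {p \<in> partitions (nat m). \<forall>x\<in>set p. odd x \<longrightarrow> count_list p x = 1})"

lemma pod_0: "pod 0 = 1"
proof -
  have "{p \<in> partitions 0. \<forall>x\<in>set p. odd x \<longrightarrow> count_list p x = 1} = {[]}"
    by (auto simp: partitions_def) (metis list.set_intros(1) neq_Nil_conv less_irrefl)
  then show ?thesis by (simp add: pod_def)
qed

definition Q2 :: "nat \<Rightarrow> nat" where
  "Q2 n = card {p \<in> partitions n. distinct p \<and> (\<forall>x\<in>set p. x mod 4 \<noteq> 2)}"

end

theory Submission
  imports Defs "HOL-Computational_Algebra.Formal_Power_Series"
begin

text \<open>Write \<open>q\<close> for the variable, \<open>D(q)\<close> for the generating function of \<open>pod\<close> and
  \<open>Q(q)\<close> for that of \<open>Q2\<close>.  Expanding both as products gives \<open>D(q) = Q(q) D(q\<^sup>2)\<close>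
  (lemma \<open>pod_series_factorization\<close>); the two products differ by the factor
  \<open>\<Prod> (1 + q\<^bsup>4i\<^esup>)(1 - q\<^bsup>8i-4\<^esup>)\<close>, which is \<open>1\<close> by Euler's theorem on distinct and odd
  parts.  The exponents \<open>j(j+1)\<close> of the statement are the doubles of the triangular numbers
  \<open>j(j+1)/2\<close>, so with \<open>\<theta>\<^sub>k(q)\<close> the sum of \<open>(-1)\<^bsup>j(j+1)/2\<^esup> q\<^bsup>j(j+1)/2\<^esup>\<close> over \<open>j < 2k\<close>, the quantity
  of the theorem is the coefficient of \<open>q\<^sup>n\<close> in \<open>Q(q) S\<^sub>k(q\<^sup>2)\<close>, where
  \<open>S\<^sub>k = (-1)\<^sup>k (1 - \<theta>\<^sub>k D)\<close>.

  The heart of the matter is a truncated form of Gauss's identity \<open>\<theta>\<^sub>\<infinity> D = 1\<close>: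
  the coefficients of \<open>S\<^sub>k\<close> vanish below \<open>k(2k+1)\<close> and are positive from there on
  (lemma \<open>truncated_gauss_coefficients\<close>).  It follows from the explicit formula
  \<open>S\<^sub>k = q\<^bsup>k(2k+1)\<^esup> \<Sum>\<^sub>r t(k,r)\<close> with
  \<open>t(k,r) = (1 - q\<^bsup>2k\<^esup>) P\<^sub>k q\<^bsup>2kr\<^esup> (1 - q\<^bsup>2(k+r+1)\<^esup>)\<^bsup>-1\<^esup> D/P\<^bsub>k+r+1\<^esub>\<close>, where \<open>P\<^sub>k\<close> is the product of
  the first \<open>k\<close> factors \<open>(1 + q\<^bsup>2i+1\<^esup>)/(1 - q\<^bsup>2i+2\<^esup>)\<close> of \<open>D\<close>.  For \<open>k > 0\<close> the polynomial
  \<open>1 - q\<^bsup>2k\<^esup>\<close> cancels against a denominator of \<open>P\<^sub>k\<close>, so everything in sight has nonnegative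
  coefficients.

  The formula comes from the Rogers-Fine identity, which for \<open>y = -q\<close> rewrites the partial theta
  function \<open>\<Sum>\<^sub>j z\<^sup>j y\<^bsup>j(j+1)/2\<^esup>\<close> as \<open>\<Sum>\<^sub>r z\<^sup>r (z;q\<^sup>2)\<^bsub>r+1\<^esub>/(zy;q\<^sup>2)\<^bsub>r+1\<^esub>\<close>; one puts \<open>z = q\<^bsup>2k\<^esup>\<close> and
  multiplies by \<open>D\<close>.  No general theory is involved, because both sides obey the same recurrence
  in \<open>k\<close>, and on the right hand side the recurrence telescopes in \<open>r\<close>
  (lemma \<open>telescoping_step\<close>).  Finally, an even \<open>n\<close> at or above \<open>2k(2k+1)\<close> gets a positive
  coefficient from the constant term of \<open>Q\<close>, and an odd one from its linear term.\<close>

unbundle fps_syntax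

section \<open>Generating functions of partitions with prescribed multiplicities\<close>

definition restricted_partitions :: "(nat \<Rightarrow> nat set) \<Rightarrow> nat \<Rightarrow> nat list set" where
  "restricted_partitions A n = {p \<in> partitions n. \<forall>x. count_list p x \<in> A x}"

definition bounded_partitions :: "(nat \<Rightarrow> nat set) \<Rightarrow> nat \<Rightarrow> nat \<Rightarrow> nat list set" where
  "bounded_partitions A m n = {p \<in> restricted_partitions A n. \<forall>x\<in>set p. x \<le> m}"

definition multiplicity_series :: "nat set \<Rightarrow> nat \<Rightarrow> real fps" where
  "multiplicity_series S i = Abs_fps (\<lambda>n. if i dvd n \<and> n div i \<in> S then 1 else 0)"

lemma finite_bounded_partitions: "finite (bounded_partitions A m n)"
  by (rule finite_subset[OF _ finite_partitions[of n]])
     (auto simp: bounded_partitions_def restricted_partitions_def)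

text \<open>In a nonincreasing list the copies of an upper bound come first, so cutting them off leaves
  the list of the remaining parts.  This makes the part sizes independent of each other and gives
  the product formula below.\<close>

lemma sorted_desc_split_maximum:
  assumes "sorted_wrt (\<ge>) p" "\<forall>x\<in>set p. x \<le> (m::nat)"
  shows "replicate (count_list p m) m @ filter (\<lambda>x. x \<noteq> m) p = p"
  using assms
proof (induction p)
  case (Cons a p)
  show ?case
  proof (cases "a = m")
    case True
    then show ?thesis using Cons by simp
  next
    case False
    then have "\<forall>x\<in>set p. x \<noteq> m" using Cons.prems by force
    then have "count_list p m = 0" "filter (\<lambda>x. x \<noteq> m) p = p"
      by (auto simp: count_list_0_iff filter_id_conv)
    then show ?thesis using False by simp
  qed
qed simp

lemma count_list_filter_neq:
  "count_list (filter (\<lambda>x. x \<noteq> m) p) y = (if y = m then 0 else count_list p y)"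
  by (induction p) auto

lemma sorted_wrt_ge_replicate: "sorted_wrt (\<ge>) (replicate a (m::nat))"
  by (induction a) auto

lemma count_list_replicate: "count_list (replicate a m) y = (if y = m then a else 0)"
  by (induction a) auto

lemma bounded_partitions_Suc:
  assumes A0: "\<And>x. 0 \<in> A x"
  shows "bij_betw (\<lambda>(a, p). replicate a (Suc m) @ p)
           (SIGMA a:{a \<in> A (Suc m). a * Suc m \<le> n}. bounded_partitions A m (n - a * Suc m))
           (bounded_partitions A (Suc m) n)"
proof (rule bij_betw_byWitness[where f' = "\<lambda>p. (count_list p (Suc m), filter (\<lambda>x. x \<noteq> Suc m) p)"])
  let ?S = "SIGMA a:{a \<in> A (Suc m). a * Suc m \<le> n}. bounded_partitions A m (n - a * Suc m)"
  let ?T = "bounded_partitions A (Suc m) n"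
  let ?f = "\<lambda>(a, p). replicate a (Suc m) @ p"
  let ?g = "\<lambda>p. (count_list p (Suc m), filter (\<lambda>x. x \<noteq> Suc m) p)"
  have small: "count_list p (Suc m) = 0" if "\<forall>x\<in>set p. x \<le> m" for p
    using that by (force simp: count_list_0_iff)
  show "\<forall>s\<in>?S. ?g (?f s) = s"
    by (force simp: bounded_partitions_def count_list_replicate small filter_id_conv)
  show "\<forall>p\<in>?T. ?f (?g p) = p"
    by (auto simp: bounded_partitions_def restricted_partitions_def partitions_def
        intro!: sorted_desc_split_maximum)
  show "?f ` ?S \<subseteq> ?T"
  proof clarify
    fix a p
    assume a: "a \<in> A (Suc m)" "a * Suc m \<le> n"
      and p: "p \<in> bounded_partitions A m (n - a * Suc m)"
    have le: "\<forall>x\<in>set p. x \<le> m" using p by (simp add: bounded_partitions_def)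
    have "count_list p x = 0" if "x = Suc m" for x using small[OF le] that by simp
    then show "replicate a (Suc m) @ p \<in> ?T"
      using a p le
      by (auto simp: bounded_partitions_def restricted_partitions_def partitions_def
          sorted_wrt_append sorted_wrt_ge_replicate sum_list_replicate count_list_replicate
          intro: le_SucI)
  qed
  show "?g ` ?T \<subseteq> ?S"
  proof
    fix s assume "s \<in> ?g ` ?T"
    then obtain p where p: "p \<in> ?T" and s: "s = ?g p" by blast
    let ?a = "count_list p (Suc m)" and ?q = "filter (\<lambda>x. x \<noteq> Suc m) p"
    have split: "replicate ?a (Suc m) @ ?q = p"
      using p by (auto simp: bounded_partitions_def restricted_partitions_def partitions_def
        intro!: sorted_desc_split_maximum)
    have "sum_list (replicate ?a (Suc m) @ ?q) = n"
      unfolding split using p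
      by (simp add: bounded_partitions_def restricted_partitions_def partitions_def)
    then have sum: "?a * Suc m + sum_list ?q = n" by (simp add: sum_list_replicate)
    have "\<forall>x\<in>set ?q. x \<le> m"
      using p by (force simp: bounded_partitions_def)
    then have "?q \<in> bounded_partitions A m (n - ?a * Suc m)"
      using p sum A0
      by (auto simp: bounded_partitions_def restricted_partitions_def partitions_def
          sorted_wrt_filter count_list_filter_neq)
    moreover have "?a \<in> A (Suc m)" "?a * Suc m \<le> n"
      using p sum by (auto simp: bounded_partitions_def restricted_partitions_def)
    ultimately show "s \<in> ?S" by (simp add: s)
  qed
qed

text \<open>Induction on the largest admissible part: choosing the multiplicity of the part \<open>m + 1\<close> and a
  partition into smaller parts is a Cauchy product.\<close>

lemma bounded_partitions_series:
  assumes A0: "\<And>x. 0 \<in> A x"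
  shows "Abs_fps (\<lambda>n. real (card (bounded_partitions A m n))) =
         (\<Prod>i\<in>{1..m}. multiplicity_series (A i) i)"
proof (induction m)
  case 0
  have "bounded_partitions A 0 n = (if n = 0 then {[]} else {})" for n
  proof -
    have "p = [] \<and> n = 0" if "p \<in> bounded_partitions A 0 n" for p
      using that by (cases p) (auto simp: bounded_partitions_def restricted_partitions_def partitions_def)
    then have "bounded_partitions A 0 n \<subseteq> (if n = 0 then {[]} else {})" by auto
    moreover have "[] \<in> bounded_partitions A 0 0"
      using A0 by (simp add: bounded_partitions_def restricted_partitions_def partitions_def)
    ultimately show ?thesis by (cases "n = 0") auto
  qed
  then show ?case by (simp add: fps_eq_iff)
next
  case (Suc m)
  let ?F = "Abs_fps (\<lambda>n. real (card (bounded_partitions A m n)))"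
  have "real (card (bounded_partitions A (Suc m) n)) =
        (multiplicity_series (A (Suc m)) (Suc m) * ?F) $ n" for n
  proof -
    let ?I = "{a \<in> A (Suc m). a * Suc m \<le> n}"
    have le: "a \<le> n" if "a * Suc m \<le> n" for a
      using that by simp
    have finI: "finite ?I" by (rule finite_subset[OF _ finite_atMost[of n]]) (use le in blast)
    have image: "(\<lambda>a. a * Suc m) ` ?I = {i\<in>{0..n}. Suc m dvd i \<and> i div Suc m \<in> A (Suc m)}"
      by (auto simp: image_iff dvd_def mult.commute simp del: mult_Suc mult_Suc_right)
    have "card (bounded_partitions A (Suc m) n) =
          card (SIGMA a:?I. bounded_partitions A m (n - a * Suc m))"
      by (rule bij_betw_same_card[OF bounded_partitions_Suc, symmetric]) (rule A0)
    then have "card (bounded_partitions A (Suc m) n) =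
        (\<Sum>a\<in>?I. card (bounded_partitions A m (n - a * Suc m)))"
      by (simp only: card_SigmaI[OF finI] finite_bounded_partitions simp_thms ball_simps)
    then have "real (card (bounded_partitions A (Suc m) n)) = (\<Sum>a\<in>?I. ?F $ (n - a * Suc m))"
      by (simp only: of_nat_sum fps_nth_Abs_fps)
    also have "\<dots> = (\<Sum>i\<in>{i\<in>{0..n}. Suc m dvd i \<and> i div Suc m \<in> A (Suc m)}. ?F $ (n - i))"
      unfolding image[symmetric] by (subst sum.reindex) (auto simp: inj_on_def simp del: mult_Suc_right)
    also have "\<dots> = (\<Sum>i=0..n. if Suc m dvd i \<and> i div Suc m \<in> A (Suc m) then ?F $ (n - i) else 0)"
      by (rule sum.inter_filter) simp
    also have "\<dots> = (multiplicity_series (A (Suc m)) (Suc m) * ?F) $ n"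
      unfolding fps_mult_nth multiplicity_series_def by (intro sum.cong) auto
    finally show ?thesis .
  qed
  then have "Abs_fps (\<lambda>n. real (card (bounded_partitions A (Suc m) n))) =
      multiplicity_series (A (Suc m)) (Suc m) * ?F"
    by (simp add: fps_eq_iff)
  then show ?case by (simp add: Suc mult.commute)
qed

lemma restricted_partitions_limit:
  assumes A0: "\<And>x. 0 \<in> A x"
  shows "(\<lambda>m. \<Prod>i\<in>{1..m}. multiplicity_series (A i) i)
           \<longlonglongrightarrow> Abs_fps (\<lambda>n. real (card (restricted_partitions A n)))"
proof (rule tendsto_fpsI)
  fix n
  have "(\<Prod>i\<in>{1..m}. multiplicity_series (A i) i) $ n = real (card (restricted_partitions A n))"
    if "m \<ge> n" for m
  proof -
    have "x \<le> n" if "p \<in> partitions n" "x \<in> set p" for p x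
      using that by (auto simp: partitions_def member_le_sum_list)
    then have "bounded_partitions A m n = restricted_partitions A n"
      using that by (fastforce simp: bounded_partitions_def restricted_partitions_def)
    then show ?thesis
      by (simp only: fps_nth_Abs_fps flip: bounded_partitions_series[OF A0])
  qed
  then show "\<forall>\<^sub>F m in sequentially. (\<Prod>i\<in>{1..m}. multiplicity_series (A i) i) $ n =
      Abs_fps (\<lambda>n. real (card (restricted_partitions A n))) $ n"
    unfolding eventually_sequentially by auto
qed

lemma multiplicity_series_01: "i > 0 \<Longrightarrow> multiplicity_series {0, 1} i = 1 + fps_X ^ i"
  by (auto simp: fps_eq_iff multiplicity_series_def fps_X_power_nth dvd_def)

lemma multiplicity_series_0: "i > 0 \<Longrightarrow> multiplicity_series {0} i = 1"
  by (auto simp: fps_eq_iff multiplicity_series_def dvd_def)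

lemma multiplicity_series_UNIV:
  assumes "i > 0"
  shows "multiplicity_series UNIV i = inverse (1 - fps_X ^ i)"
proof -
  have "(1 - fps_X ^ i) * multiplicity_series UNIV i = 1"
  proof (rule fps_ext)
    fix n
    have "i dvd n - i \<longleftrightarrow> i dvd n" if "i \<le> n" using that by (simp add: dvd_minus_self)
    then show "((1 - fps_X ^ i) * multiplicity_series UNIV i) $ n = (1::real fps) $ n"
      using assms by (auto simp: left_diff_distrib fps_X_power_mult_nth multiplicity_series_def
          dest: dvd_imp_le)
  qed
  then show ?thesis by (rule fps_inverse_unique[symmetric])
qed

section \<open>Limits of formal power series\<close>

text \<open>In the metric of formal power series, convergence means that each coefficient is eventually
  constant.  Infinite products are handled as limits of their partial products in this sense.\<close>

lemma tendsto_fps_mult: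
  fixes f g :: "'b \<Rightarrow> 'a::comm_ring_1 fps"
  assumes "(f \<longlongrightarrow> a) F" "(g \<longlongrightarrow> b) F"
  shows "((\<lambda>x. f x * g x) \<longlongrightarrow> a * b) F"
proof (rule tendsto_fpsI)
  fix n
  have "\<forall>\<^sub>F x in F. \<forall>i\<in>{0..n}. f x $ i = a $ i" "\<forall>\<^sub>F x in F. \<forall>i\<in>{0..n}. g x $ i = b $ i"
    using assms by (auto simp: tendsto_fps_iff eventually_ball_finite_distrib)
  then show "\<forall>\<^sub>F x in F. (f x * g x) $ n = (a * b) $ n"
    by eventually_elim (simp add: fps_mult_nth)
qed

lemma fps_compose_X_power_nth:
  assumes "d > 0"
  shows "((f :: 'a::comm_ring_1 fps) oo fps_X ^ d) $ n = (if d dvd n then f $ (n div d) else 0)"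
proof -
  have "(f oo fps_X ^ d) $ n = (\<Sum>i=0..n. if n = d * i then f $ i else 0)"
    by (simp add: fps_compose_nth fps_X_power_nth flip: power_mult)
       (intro sum.cong, auto)
  also have "\<dots> = (\<Sum>i\<in>{0..n}. if i = n div d then (if d dvd n then f $ i else 0) else 0)"
    using assms by (intro sum.cong) auto
  also have "\<dots> = (if d dvd n then f $ (n div d) else 0)"
    by (simp add: sum.delta)
  finally show ?thesis .
qed

lemma tendsto_fps_compose_X_power:
  fixes f :: "'b \<Rightarrow> 'a::comm_ring_1 fps"
  assumes "(f \<longlongrightarrow> a) F" "d > 0"
  shows "((\<lambda>x. f x oo fps_X ^ d) \<longlongrightarrow> a oo fps_X ^ d) F"
proof (rule tendsto_fpsI)
  fix n
  have "\<forall>\<^sub>F x in F. f x $ (n div d) = a $ (n div d)"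
    using assms by (simp add: tendsto_fps_iff)
  then show "\<forall>\<^sub>F x in F. (f x oo fps_X ^ d) $ n = (a oo fps_X ^ d) $ n"
    by eventually_elim (simp add: fps_compose_X_power_nth assms)
qed

lemma fps_X_power_dvd_nth: "fps_X ^ N dvd (f :: real fps) \<Longrightarrow> n < N \<Longrightarrow> f $ n = 0"
  by (auto simp: dvd_def fps_X_power_mult_nth)

text \<open>Applied with \<open>c = fps_X ^ N\<close>: factors that agree with \<open>1\<close> below degree \<open>N\<close> have a product
  with the same property.\<close>

lemma dvd_prod_minus_1:
  fixes f :: "'b \<Rightarrow> 'a::comm_ring_1"
  assumes "\<And>i. i \<in> I \<Longrightarrow> c dvd f i - 1"
  shows "c dvd prod f I - 1"
  using assms
proof (induction I rule: infinite_finite_induct)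
  case (insert i I)
  have "prod f (insert i I) - 1 = f i * (prod f I - 1) + (f i - 1)"
    using insert by (simp add: algebra_simps)
  moreover have "c dvd f i * (prod f I - 1) + (f i - 1)"
    using insert by (intro dvd_add dvd_mult) auto
  ultimately show ?case by (simp only:)
qed auto

lemma tendsto_fps_1:
  fixes f :: "nat \<Rightarrow> real fps"
  assumes "\<And>n. fps_X ^ n dvd f n - 1"
  shows "f \<longlonglongrightarrow> 1"
proof (rule tendsto_fpsI)
  fix n
  have "f m $ n = 1 $ n" if "m \<ge> Suc n" for m
    using fps_X_power_dvd_nth[OF assms[of m], of n] that by simp
  then show "\<forall>\<^sub>F m in sequentially. f m $ n = 1 $ n"
    unfolding eventually_sequentially by blast
qed

section \<open>The generating functions of pod and Q2\<close>

definition pod_series :: "real fps" where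
  "pod_series = Abs_fps (\<lambda>n. real (pod (int n)))"

definition Q2_series :: "real fps" where
  "Q2_series = Abs_fps (\<lambda>n. real (Q2 n))"

definition pod_factor :: "nat \<Rightarrow> real fps" where
  "pod_factor i = (1 + fps_X ^ (2 * i + 1)) * inverse (1 - fps_X ^ (2 * i + 2))"

lemma prod_blocks:
  fixes f :: "nat \<Rightarrow> 'a::comm_monoid_mult"
  shows "(\<Prod>i\<in>{1..d * m}. f i) = (\<Prod>i<m. \<Prod>j<d. f (d * i + j + 1))"
proof -
  have shift: "(\<Prod>i\<in>{1..n}. f i) = (\<Prod>i<n. f (i + 1))" for n
    by (induction n) auto
  have split: "(\<Prod>i<a + b. g i) = (\<Prod>i<a. g i) * (\<Prod>j<b. g (a + j))"
    for a b and g :: "nat \<Rightarrow> 'a"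
    by (induction b) (auto simp: mult.assoc)
  show ?thesis
    unfolding shift 
  proof (induction m)
    case (Suc m)
    have "d * Suc m = d * m + d" by simp
    then show ?case by (simp only: split Suc prod.lessThan_Suc add.assoc)
  qed simp
qed

text \<open>Grouping the part sizes by residues modulo \<open>d\<close> turns the product over all part sizes into
  one whose factors have a uniform shape.\<close>

lemma restricted_partitions_limit_blocks:
  assumes "\<And>x. 0 \<in> A x" "d > 0"
  shows "(\<lambda>m. \<Prod>i<m. \<Prod>j<d. multiplicity_series (A (d * i + j + 1)) (d * i + j + 1))
           \<longlonglongrightarrow> Abs_fps (\<lambda>n. real (card (restricted_partitions A n)))"
proof -
  have "strict_mono (\<lambda>m. d * m)" using assms by (simp add: strict_mono_def)
  from LIMSEQ_subseq_LIMSEQ[OF restricted_partitions_limit[of A] this] assms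
  show ?thesis by (simp only: prod_blocks o_def)
qed

lemma pod_limit_blocks:
  assumes "d > 0"
  shows "(\<lambda>m. \<Prod>i<m. \<Prod>j<d. multiplicity_series
            (if odd (d * i + j + 1) then {0, 1} else UNIV) (d * i + j + 1)) \<longlonglongrightarrow> pod_series"
proof -
  have *: "(\<forall>x\<in>set p. odd x \<longrightarrow> count_list p x = 1) \<longleftrightarrow>
    (\<forall>x. count_list p x \<in> (if odd x then {0, 1} else UNIV))" for p :: "nat list"
    by (metis One_nat_def UNIV_I count_list_0_iff empty_iff insertCI insertE zero_neq_one)
  have "pod (int n) = card (restricted_partitions (\<lambda>x. if odd x then {0, 1} else UNIV) n)" for n
    unfolding pod_def restricted_partitions_def * by simp
  then show ?thesis
    unfolding pod_series_def using assms
    by (simp only:) (rule restricted_partitions_limit_blocks, auto)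
qed

lemma Q2_limit_blocks:
  assumes "d > 0"
  shows "(\<lambda>m. \<Prod>i<m. \<Prod>j<d. multiplicity_series
            (if (d * i + j + 1) mod 4 = 2 then {0} else {0, 1}) (d * i + j + 1)) \<longlonglongrightarrow> Q2_series"
proof -
  have distinct: "distinct p \<longleftrightarrow> (\<forall>x. count_list p x \<le> 1)" for p :: "nat list"
  proof (induction p)
    case (Cons a p)
    have "(\<forall>x. count_list (a # p) x \<le> 1) \<longleftrightarrow> count_list p a = 0 \<and> (\<forall>x. count_list p x \<le> 1)"
    proof safe
      assume *: "\<forall>x. count_list (a # p) x \<le> 1"
      show "count_list p a = 0" using *[rule_format, of a] by simp
      show "count_list p x \<le> 1" for x using *[rule_format, of x] by (auto split: if_splits)
    qed auto
    then show ?case using Cons by (simp add: count_list_0_iff)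
  qed simp
  have *: "distinct p \<and> (\<forall>x\<in>set p. x mod 4 \<noteq> 2) \<longleftrightarrow>
    (\<forall>x. count_list p x \<in> (if x mod 4 = 2 then {0} else {0, 1}))" for p :: "nat list"
  proof -
    have "(\<forall>x\<in>set p. x mod 4 \<noteq> 2) \<longleftrightarrow> (\<forall>x. x mod 4 = 2 \<longrightarrow> count_list p x = 0)"
      by (auto simp: count_list_0_iff)
    moreover have "count_list p x \<in> (if x mod 4 = 2 then {0} else {0, 1}) \<longleftrightarrow>
        count_list p x \<le> 1 \<and> (x mod 4 = 2 \<longrightarrow> count_list p x = 0)" for x
      by auto
    ultimately show ?thesis unfolding distinct by blast
  qed
  have "Q2 n = card (restricted_partitions (\<lambda>x. if x mod 4 = 2 then {0} else {0, 1}) n)" for n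
    unfolding Q2_def restricted_partitions_def * ..
  then show ?thesis
    unfolding Q2_series_def using assms
    by (simp only:) (rule restricted_partitions_limit_blocks, auto)
qed

lemma pod_product: "(\<lambda>m. \<Prod>i<m. pod_factor i) \<longlonglongrightarrow> pod_series"
proof -
  have "(\<Prod>j<2. multiplicity_series (if odd (2 * i + j + 1) then {0, 1} else UNIV) (2 * i + j + 1))
      = pod_factor i" for i
  proof -
    have two: "{..<2::nat} = {0, 1}" by auto
    have "odd (2 * i + 0 + 1)" "even (2 * i + 1 + 1)" by auto
    then have "(\<Prod>j<2. multiplicity_series (if odd (2 * i + j + 1) then {0, 1} else UNIV) (2 * i + j + 1))
      = multiplicity_series {0, 1} (2 * i + 1) * multiplicity_series UNIV (2 * i + 2)"
      unfolding two by simp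
    also have "\<dots> = pod_factor i"
      by (simp only: pod_factor_def multiplicity_series_01 multiplicity_series_UNIV)
    finally show ?thesis .
  qed
  then show ?thesis using pod_limit_blocks[of 2] by simp
qed

lemma Q2_product:
  "(\<lambda>m. \<Prod>i<m. (1 + fps_X ^ (4 * i + 1)) * (1 + fps_X ^ (4 * i + 3)) * (1 + fps_X ^ (4 * i + 4))) \<longlonglongrightarrow> Q2_series"
proof -
  have "(\<Prod>j<4. multiplicity_series (if (4 * i + j + 1) mod 4 = 2 then {0} else {0, 1}) (4 * i + j + 1))
      = (1 + fps_X ^ (4 * i + 1)) * (1 + fps_X ^ (4 * i + 3)) * (1 + fps_X ^ (4 * i + 4))" for i
  proof -
    define g where "g j = multiplicity_series (if (4 * i + j + 1) mod 4 = 2 then {0} else {0, 1}) (4 * i + j + 1)" for j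
    have no: "(4 * i + 0 + 1) mod 4 \<noteq> 2" "(4 * i + 2 + 1) mod 4 \<noteq> 2"
      "(4 * i + 3 + 1) mod 4 \<noteq> 2" and yes: "(4 * i + 1 + 1) mod 4 = 2" by presburger+
    have vals: "g 0 = 1 + fps_X ^ (4 * i + 0 + 1)" "g 1 = 1"
      "g 2 = 1 + fps_X ^ (4 * i + 2 + 1)" "g 3 = 1 + fps_X ^ (4 * i + 3 + 1)"
      unfolding g_def if_not_P[OF no(1)] if_not_P[OF no(2)] if_not_P[OF no(3)] if_P[OF yes]
      by (intro multiplicity_series_01 multiplicity_series_0; simp)+
    have "(\<Prod>j<4. g j) = g 0 * g 1 * g 2 * g 3"
      by (simp add: eval_nat_numeral)
    also have "\<dots> = (1 + fps_X ^ (4 * i + 1)) * (1 + fps_X ^ (4 * i + 3)) * (1 + fps_X ^ (4 * i + 4))"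
    proof -
      have "4 * i + 0 + 1 = 4 * i + 1" "4 * i + 2 + 1 = 4 * i + 3" "4 * i + 3 + 1 = 4 * i + 4"
        by simp_all
      then show ?thesis unfolding vals by (simp only: mult_1_right)
    qed
    finally show ?thesis unfolding g_def .
  qed
  then show ?thesis using Q2_limit_blocks[of 4] by simp
qed

text \<open>Euler's theorem that partitions into distinct parts and into odd parts are equinumerous, in
  product form and with all exponents scaled by \<open>d\<close>.  Multiplying the partial product by
  \<open>\<Prod>\<^bsub>i\<le>m\<^esub> (1 - q\<^bsup>di\<^esup>)\<close> gives the same product up to \<open>2m\<close>, so the partial product is
  \<open>\<Prod>\<^bsub>m<i\<le>2m\<^esub> (1 - q\<^bsup>di\<^esup>)\<close>, which differs from \<open>1\<close> only in degrees above \<open>m\<close>.\<close>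

lemma euler_product_limit:
  assumes "d > 0"
  shows "(\<lambda>m. \<Prod>i<m. (1 + fps_X ^ (d * (i + 1))) * (1 - fps_X ^ (d * (2 * i + 1))) :: real fps) \<longlonglongrightarrow> 1"
proof (rule tendsto_fps_1)
  fix m
  let ?p = "\<lambda>i. 1 - fps_X ^ (d * (i + 1)) :: real fps"
  let ?f = "\<lambda>i. (1 + fps_X ^ (d * (i + 1))) * (1 - fps_X ^ (d * (2 * i + 1))) :: real fps"
  have "(\<Prod>i<m. ?f i) * (\<Prod>i<m. ?p i) = (\<Prod>i<2 * m. ?p i)"
  proof (induction m)
    case (Suc m)
    have square: "fps_X ^ (d * (2 * m + 1 + 1)) = (fps_X ^ (d * (m + 1)) :: real fps)\<^sup>2"
      by (simp add: algebra_simps flip: power_mult)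
    have step: "?f m * ?p m = ?p (2 * m) * ?p (2 * m + 1)"
      unfolding square power2_eq_square by (simp add: algebra_simps)
    have "(\<Prod>i<Suc m. ?f i) * (\<Prod>i<Suc m. ?p i) =
        ((\<Prod>i<m. ?f i) * (\<Prod>i<m. ?p i)) * (?f m * ?p m)"
      by (simp only: prod.lessThan_Suc mult_ac)
    also have "\<dots> = (\<Prod>i<2 * Suc m. ?p i)"
      unfolding Suc step by (simp add: mult.assoc)
    finally show ?case .
  qed simp
  also have "(\<Prod>i<2 * m. ?p i) = (\<Prod>i\<in>{m..<2 * m}. ?p i) * (\<Prod>i<m. ?p i)"
    by (simp add: prod.atLeastLessThan_concat lessThan_atLeast0 mult.commute)
  finally have "(\<Prod>i<m. ?f i) * (\<Prod>i<m. ?p i) = (\<Prod>i\<in>{m..<2 * m}. ?p i) * (\<Prod>i<m. ?p i)" .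
  moreover have "(\<Prod>i<m. ?p i) \<noteq> 0"
  proof -
    have "?p i $ 0 \<noteq> 0" for i using assms by simp
    then have "?p i \<noteq> 0" for i by (metis fps_zero_nth)
    then show ?thesis by simp
  qed
  ultimately have "(\<Prod>i<m. ?f i) = (\<Prod>i\<in>{m..<2 * m}. ?p i)" by simp
  moreover have "fps_X ^ m dvd (\<Prod>i\<in>{m..<2 * m}. ?p i) - 1"
  proof (rule dvd_prod_minus_1)
    fix i assume "i \<in> {m..<2 * m}"
    then have "m \<le> i + 1" by auto
    also have "\<dots> \<le> d * (i + 1)" using assms by (cases d) simp_all
    finally show "fps_X ^ m dvd ?p i - 1" by (simp add: le_imp_power_dvd)
  qed
  ultimately show "fps_X ^ m dvd (\<Prod>i<m. ?f i) - 1" by simp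
qed

lemma inverse_one_minus_X_power:
  "n > 0 \<Longrightarrow> (1 - fps_X ^ n) * inverse (1 - fps_X ^ n :: real fps) = 1"
  by (rule inverse_mult_eq_1') simp

text \<open>Compare the first \<open>2m\<close> factors of \<open>D(q)\<close> with the first \<open>m\<close> blocks of \<open>Q(q)\<close> and the first \<open>m\<close>
  factors of \<open>D(q\<^sup>2)\<close>: the quotient is a partial product of Euler's identity in \<open>q\<^sup>4\<close>.\<close>

lemma pod_series_factorization:
  "pod_series = Q2_series * (pod_series oo fps_X ^ 2)"
proof -
  let ?a = "\<lambda>i. (1 + fps_X ^ (4 * i + 1)) * (1 + fps_X ^ (4 * i + 3)) * (1 + fps_X ^ (4 * i + 4)) :: real fps"
  let ?e = "\<lambda>i. (1 + fps_X ^ (4 * (i + 1))) * (1 - fps_X ^ (4 * (2 * i + 1))) :: real fps"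
  have comp_factor: "pod_factor i oo fps_X ^ 2 =
      (1 + fps_X ^ (4 * i + 2)) * inverse (1 - fps_X ^ (4 * i + 4))" for i
  proof -
    have X2: "(fps_X ^ 2 :: real fps) $ 0 = 0" by simp
    have pow: "(fps_X ^ n :: real fps) oo fps_X ^ 2 = fps_X ^ (2 * n)" for n
      by (simp add: fps_compose_power[OF X2, symmetric] power_mult)
    have inv: "inverse (1 - fps_X ^ n :: real fps) oo fps_X ^ 2 = inverse (1 - fps_X ^ (2 * n))"
      if "n > 0" for n
      by (subst fps_inverse_compose[OF X2]) (use that in \<open>simp_all add: fps_compose_sub_distrib pow\<close>)
    have "pod_factor i oo fps_X ^ 2 =
      (1 + fps_X ^ (2 * (2 * i + 1))) * inverse (1 - fps_X ^ (2 * (2 * i + 2)))"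
      unfolding pod_factor_def fps_compose_mult_distrib[OF X2] fps_compose_add_distrib
        pow fps_compose_1 by (subst inv) simp_all
    moreover have "2 * (2 * i + 1) = 4 * i + 2" "2 * (2 * i + 2) = 4 * i + 4" by simp_all
    ultimately show ?thesis by (simp only:)
  qed
  have "(\<Prod>i<m. ?a i) * (\<Prod>i<m. (1 + fps_X ^ (4 * i + 2)) * inverse (1 - fps_X ^ (4 * i + 4))) =
      (\<Prod>i<2 * m. pod_factor i) * (\<Prod>i<m. ?e i)" for m
  proof (induction m)
    case (Suc m)
    define b c :: "real fps" where "b = inverse (1 - fps_X ^ (4 * m + 2))" and "c = inverse (1 - fps_X ^ (4 * m + 4))"
    have b: "(1 - fps_X ^ (4 * m + 2)) * b = 1"
      unfolding b_def by (rule inverse_one_minus_X_power) simp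
    have e: "?e m = (1 + fps_X ^ (4 * m + 4)) * ((1 - fps_X ^ (4 * m + 2)) * (1 + fps_X ^ (4 * m + 2)))"
    proof -
      have square: "fps_X ^ (4 * (2 * m + 1)) = (fps_X ^ (4 * m + 2) :: real fps) ^ 2"
        unfolding power_mult[symmetric] by (rule arg_cong[of _ _ "power fps_X"]) simp
      have four: "4 * (m + 1) = 4 * m + 4" by simp
      have "(1 - w\<^sup>2) = (1 - w) * (1 + w)" for w :: "real fps"
        by (simp add: algebra_simps power2_eq_square)
      then show ?thesis unfolding square four by (simp only:)
    qed
    have f: "pod_factor (2 * m) = (1 + fps_X ^ (4 * m + 1)) * b"
      "pod_factor (2 * m + 1) = (1 + fps_X ^ (4 * m + 3)) * c"
    proof -
      have "2 * (2 * m) = 4 * m" "2 * (2 * m + 1) + 1 = 4 * m + 3" "2 * (2 * m + 1) + 2 = 4 * m + 4" by simp_all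
      then show "pod_factor (2 * m) = (1 + fps_X ^ (4 * m + 1)) * b"
        "pod_factor (2 * m + 1) = (1 + fps_X ^ (4 * m + 3)) * c"
        unfolding pod_factor_def b_def c_def by (simp_all only:)
    qed
    have "pod_factor (2 * m) * pod_factor (2 * m + 1) * ?e m =
      ?a m * ((1 + fps_X ^ (4 * m + 2)) * c) * ((1 - fps_X ^ (4 * m + 2)) * b)"
      unfolding e f by (simp only: mult_ac)
    also have "\<dots> = ?a m * ((1 + fps_X ^ (4 * m + 2)) * c)" by (simp only: b mult_1_right)
    finally have step: "pod_factor (2 * m) * pod_factor (2 * m + 1) * ?e m =
      ?a m * ((1 + fps_X ^ (4 * m + 2)) * c)" .
    have "(\<Prod>i<Suc m. ?a i) * (\<Prod>i<Suc m. (1 + fps_X ^ (4 * i + 2)) * inverse (1 - fps_X ^ (4 * i + 4))) =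
       ((\<Prod>i<m. ?a i) * (\<Prod>i<m. (1 + fps_X ^ (4 * i + 2)) * inverse (1 - fps_X ^ (4 * i + 4)))) *
       (?a m * ((1 + fps_X ^ (4 * m + 2)) * c))"
      unfolding prod.lessThan_Suc c_def by (simp only: mult_ac)
    also have "\<dots> = ((\<Prod>i<2 * m. pod_factor i) * (\<Prod>i<m. ?e i)) *
        (pod_factor (2 * m) * pod_factor (2 * m + 1) * ?e m)"
      unfolding Suc step ..
    also have "\<dots> = (\<Prod>i<2 * Suc m. pod_factor i) * (\<Prod>i<Suc m. ?e i)"
      by (simp add: mult_ac)
    finally show ?case .
  qed simp
  then have eq: "(\<Prod>i<m. ?a i) * ((\<Prod>i<m. pod_factor i) oo fps_X ^ 2) =
      (\<Prod>i<2 * m. pod_factor i) * (\<Prod>i<m. ?e i)" for m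
    by (simp add: fps_compose_prod_distrib comp_factor)
  have "(\<lambda>m. (\<Prod>i<m. ?a i) * ((\<Prod>i<m. pod_factor i) oo fps_X ^ 2)) \<longlonglongrightarrow> Q2_series * (pod_series oo fps_X ^ 2)"
    by (intro tendsto_fps_mult tendsto_fps_compose_X_power Q2_product pod_product) simp
  moreover have "strict_mono (\<lambda>m. 2 * m :: nat)" by (simp add: strict_mono_def)
  from LIMSEQ_subseq_LIMSEQ[OF pod_product this]
  have "(\<lambda>m. (\<Prod>i<2 * m. pod_factor i) * (\<Prod>i<m. ?e i)) \<longlonglongrightarrow> pod_series * 1"
    by (intro tendsto_fps_mult euler_product_limit) (simp_all add: o_def)
  ultimately have "Q2_series * (pod_series oo fps_X ^ 2) = pod_series * 1"
    unfolding eq by (rule LIMSEQ_unique)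
  then show ?thesis by simp
qed

section \<open>Series with nonnegative coefficients\<close>

definition nonneg_series :: "real fps \<Rightarrow> bool" where
  "nonneg_series f \<longleftrightarrow> (\<forall>n. f $ n \<ge> 0)"

lemma nonneg_series_mult: "nonneg_series f \<Longrightarrow> nonneg_series g \<Longrightarrow> nonneg_series (f * g)"
  by (auto simp: nonneg_series_def fps_mult_nth intro!: sum_nonneg)

lemma nonneg_series_add: "nonneg_series f \<Longrightarrow> nonneg_series g \<Longrightarrow> nonneg_series (f + g)"
  by (auto simp: nonneg_series_def)

lemma nonneg_series_1: "nonneg_series 1"
  by (auto simp: nonneg_series_def)

lemma nonneg_series_X_power: "nonneg_series (fps_X ^ k)"
  by (auto simp: nonneg_series_def fps_X_power_nth)

lemma nonneg_series_sum: "(\<And>i. i \<in> I \<Longrightarrow> nonneg_series (f i)) \<Longrightarrow> nonneg_series (sum f I)"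
  by (auto simp: nonneg_series_def fps_sum_nth intro!: sum_nonneg)

lemma nonneg_series_prod: "(\<And>i. i \<in> I \<Longrightarrow> nonneg_series (f i)) \<Longrightarrow> nonneg_series (prod f I)"
  by (induction I rule: infinite_finite_induct) (auto intro: nonneg_series_mult nonneg_series_1)

lemma nonneg_series_geometric: "i > 0 \<Longrightarrow> nonneg_series (inverse (1 - fps_X ^ i))"
  by (simp add: multiplicity_series_UNIV[symmetric] nonneg_series_def multiplicity_series_def)

lemma nonneg_series_pod_factor: "nonneg_series (pod_factor i)"
  unfolding pod_factor_def
  by (intro nonneg_series_mult nonneg_series_add nonneg_series_1 nonneg_series_X_power
      nonneg_series_geometric) simp

lemma nonneg_series_limit:
  assumes "f \<longlonglongrightarrow> a" "\<And>n. nonneg_series (f n)"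
  shows "nonneg_series a"
  unfolding nonneg_series_def
proof
  fix k
  have "\<forall>\<^sub>F n in sequentially. f n $ k = a $ k" using assms(1) by (simp add: tendsto_fps_iff)
  then obtain n where "f n $ k = a $ k" using eventually_happens'[OF sequentially_bot] by blast
  then show "a $ k \<ge> 0" using assms(2)[of n] unfolding nonneg_series_def by metis
qed

lemma nonneg_series_mult_ge:
  assumes "nonneg_series f" "nonneg_series g" "g $ 0 \<ge> 1"
  shows "f $ n \<le> (f * g) $ n"
proof -
  have "f $ n \<le> f $ n * g $ (n - n)" using mult_left_mono[of 1 "g $ 0" "f $ n"] assms by (simp add: nonneg_series_def)
  also have "\<dots> \<le> (f * g) $ n"
    unfolding fps_mult_nth using assms
    by (intro member_le_sum) (auto simp: nonneg_series_def)
  finally show ?thesis .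
qed

section \<open>Gauss's theta identity and its truncation\<close>

definition pod_prefix :: "nat \<Rightarrow> real fps" where
  "pod_prefix k = (\<Prod>i<k. pod_factor i)"

definition pod_tail :: "nat \<Rightarrow> real fps" where
  "pod_tail k = pod_series * inverse (pod_prefix k)"

lemma pod_factor_0 [simp]: "pod_factor i $ 0 = 1"
  by (simp add: pod_factor_def)

lemma pod_prefix_nth_0: "pod_prefix k $ 0 = 1"
  unfolding pod_prefix_def by (induction k) simp_all

lemma pod_prefix_mult_tail: "pod_prefix k * pod_tail k = pod_series"
proof -
  have "pod_prefix k * inverse (pod_prefix k) = 1"
    by (rule inverse_mult_eq_1') (simp add: pod_prefix_nth_0)
  then show ?thesis unfolding pod_tail_def mult.left_commute[of _ pod_series] by (simp only: mult_1_right)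
qed

lemma pod_prefix_nonzero: "pod_prefix k \<noteq> 0"
  using pod_prefix_nth_0[of k] by (metis fps_zero_nth zero_neq_one)

lemma pod_tail_step: "pod_tail k = pod_factor k * pod_tail (Suc k)"
proof -
  have "pod_prefix k * pod_tail k = pod_prefix k * (pod_factor k * pod_tail (Suc k))"
    unfolding pod_prefix_mult_tail
    using pod_prefix_mult_tail[of "Suc k"] by (simp add: pod_prefix_def mult.assoc)
  then show ?thesis using pod_prefix_nonzero by simp
qed

text \<open>The tail is defined by division; as a limit of products it is visibly nonnegative and close to
  \<open>1\<close>.\<close>

lemma pod_tail_limit: "(\<lambda>m. \<Prod>i\<in>{k..<k + m}. pod_factor i) \<longlonglongrightarrow> pod_tail k"
proof -
  have "(\<Prod>i\<in>{k..<k + m}. pod_factor i) = (\<Prod>i<m + k. pod_factor i) * inverse (pod_prefix k)" for m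
  proof -
    have "(\<Prod>i<m + k. pod_factor i) = pod_prefix k * (\<Prod>i\<in>{k..<k + m}. pod_factor i)"
      by (simp add: pod_prefix_def lessThan_atLeast0 prod.atLeastLessThan_concat add.commute)
    moreover have "pod_prefix k * inverse (pod_prefix k) = 1"
      by (rule inverse_mult_eq_1') (simp add: pod_prefix_nth_0)
    moreover have "pod_prefix k * t * inverse (pod_prefix k) = t * (pod_prefix k * inverse (pod_prefix k))" for t
      by (simp only: mult_ac)
    ultimately show ?thesis by (simp only: mult_1_right)
  qed
  moreover have "(\<lambda>m. (\<Prod>i<m + k. pod_factor i) * inverse (pod_prefix k)) \<longlonglongrightarrow> pod_tail k"
    unfolding pod_tail_def
    by (rule tendsto_fps_mult[OF LIMSEQ_ignore_initial_segment[OF pod_product] tendsto_const])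
  ultimately show ?thesis by (simp only:)
qed

lemma nonneg_series_pod_tail: "nonneg_series (pod_tail k)"
  by (rule nonneg_series_limit[OF pod_tail_limit])
     (intro nonneg_series_prod nonneg_series_pod_factor)

lemma pod_tail_near_1: "fps_X ^ k dvd pod_tail k - 1"
proof -
  have factor: "fps_X ^ k dvd pod_factor i - 1" if "i \<ge> k" for i
  proof -
    have "(1 - fps_X ^ (2 * i + 2)) * inverse (1 - fps_X ^ (2 * i + 2)) = (1 :: real fps)"
      by (rule inverse_one_minus_X_power) simp
    moreover have "(1 + a) * g - 1 = (a + b) * g" if "(1 - b) * g = 1" for a b g :: "real fps"
      using that by algebra
    ultimately have "pod_factor i - 1 =
        (fps_X ^ (2 * i + 1) + fps_X ^ (2 * i + 2)) * inverse (1 - fps_X ^ (2 * i + 2))"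
      unfolding pod_factor_def by blast
    also have "fps_X ^ k dvd \<dots>"
      using that by (intro dvd_mult2 dvd_add le_imp_power_dvd) auto
    finally show ?thesis .
  qed
  have "(pod_tail k - 1) $ n = 0" if "n < k" for n
  proof -
    have "\<forall>\<^sub>F m in sequentially. (\<Prod>i\<in>{k..<k + m}. pod_factor i) $ n = pod_tail k $ n"
      using pod_tail_limit by (simp add: tendsto_fps_iff)
    then obtain m where "(\<Prod>i\<in>{k..<k + m}. pod_factor i) $ n = pod_tail k $ n"
      using eventually_happens'[OF sequentially_bot] by blast
    moreover have "((\<Prod>i\<in>{k..<k + m}. pod_factor i) - 1) $ n = 0"
      by (rule fps_X_power_dvd_nth[OF dvd_prod_minus_1 that]) (simp add: factor)
    ultimately show ?thesis by simp
  qed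
  then have "pod_tail k - 1 = fps_X ^ k * fps_shift k (pod_tail k - 1)"
    by (auto simp: fps_eq_iff fps_X_power_mult_nth)
  then show ?thesis by (metis dvd_triv_left)
qed

text \<open>In the notation of \<open>q\<close>-Pochhammer symbols with \<open>z = q\<^bsup>2k\<^esup>\<close> this is
  \<open>D z\<^sup>r (z;q\<^sup>2)\<^bsub>r+1\<^esub>/(-zq;q\<^sup>2)\<^bsub>r+1\<^esub>\<close>, the summand of the Rogers-Fine expansion of the partial
  theta function.\<close>

definition remainder_term :: "nat \<Rightarrow> nat \<Rightarrow> real fps" where
  "remainder_term k r = (1 - fps_X ^ (2 * k)) * pod_prefix k * fps_X ^ (2 * k * r) *
     inverse (1 - fps_X ^ (2 * (k + r) + 2)) * pod_tail (k + r + 1)"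

text \<open>The antidifference in \<open>r\<close>, up to sign, of the recurrence satisfied by the summands.  It is found by
  the ansatz of \<open>z\<^sup>r (zq\<^sup>2;q\<^sup>2)\<^sub>r/(-zq;q\<^sup>2)\<^bsub>r+1\<^esub>\<close> times a linear polynomial in \<open>q\<^bsup>2r\<^esup>\<close>; at \<open>r = 0\<close> it gives the
  inhomogeneous part \<open>(1 - q\<^bsup>2k+1\<^esup>) D\<close>, and it disappears as \<open>r\<close> grows unless \<open>k = 0\<close>.\<close>

definition telescoper :: "nat \<Rightarrow> nat \<Rightarrow> real fps" where
  "telescoper k r = (1 - fps_X ^ (2 * (2 * k + r + 1))) * pod_prefix k * fps_X ^ (2 * k * r) *
     inverse (1 - fps_X ^ (2 * (k + r) + 2)) * pod_tail (k + r + 1)"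

lemma pod_prefix_Suc:
  "(1 - fps_X ^ (2 * Suc k)) * pod_prefix (Suc k) = pod_prefix k * (1 + fps_X ^ (2 * k + 1))"
proof -
  have "(1 - fps_X ^ (2 * k + 2)) * inverse (1 - fps_X ^ (2 * k + 2)) = (1 :: real fps)"
    by (rule inverse_one_minus_X_power) simp
  moreover have "b * (c * (d * g)) = c * d" if "b * g = 1" for b c d g :: "real fps"
    using arg_cong[OF that, of "\<lambda>x. x * (c * d)"] by (simp only: mult_ac mult_1_left)
  moreover have "2 * Suc k = 2 * k + 2" by simp
  ultimately show ?thesis
    unfolding pod_prefix_def prod.lessThan_Suc pod_factor_def by presburger
qed

text \<open>After removing the common factor of the four terms, what remains is a polynomial identity in
  \<open>q\<close>, \<open>z = q\<^bsup>2k\<^esup>\<close> and \<open>v = q\<^bsup>2r\<^esup>\<close>.\<close>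

lemma telescoping_step:
  "remainder_term k r + fps_X ^ (4 * k + 3) * remainder_term (k + 1) r
     = telescoper k r - telescoper k (r + 1)"
proof -
  let ?X = "fps_X :: real fps"
  define z v where "z = ?X ^ (2 * k)" and "v = ?X ^ (2 * r)"
  define g h where "g = inverse (1 - ?X ^ (2 * (k + r) + 2))"
    and "h = inverse (1 - ?X ^ (2 * (k + r + 1) + 2))"
  define e where "e = pod_tail (k + r + 2)"
  define c where "c = pod_prefix k"
  define y where "y = ?X ^ (2 * k * r)"
  \<comment> \<open>The terms at \<open>k + 1\<close> and at \<open>r + 1\<close> lack the factor \<open>g\<close>; this equation inserts it.\<close>
  have gd: "(1 - z * v * ?X\<^sup>2) * g = 1"
  proof -
    have "z * v * ?X\<^sup>2 = ?X ^ (2 * (k + r) + 2)"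
      unfolding z_def v_def power_add[symmetric] by (rule arg_cong[of _ _ "power fps_X"]) simp
    then show ?thesis unfolding g_def by (simp only:) (rule inverse_one_minus_X_power, simp)
  qed
  have tail: "pod_tail (k + r + 1) = (1 + z * v * ?X ^ 3) * h * e"
  proof -
    have "z * v * ?X ^ 3 = ?X ^ (2 * (k + r + 1) + 1)"
      unfolding z_def v_def power_add[symmetric] by (rule arg_cong[of _ _ "power fps_X"]) simp
    moreover have "pod_tail (k + r + 1) = pod_factor (k + r + 1) * e"
      unfolding e_def using pod_tail_step[of "k + r + 1"] by simp
    ultimately show ?thesis by (simp only: pod_factor_def h_def)
  qed
  have t1: "remainder_term k r = (1 - z) * c * y * g * ((1 + z * v * ?X ^ 3) * h * e)"
    unfolding remainder_term_def tail z_def c_def y_def g_def ..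
  have t2: "remainder_term (k + 1) r = (c * (1 + z * ?X)) * (y * v) * h * e"
  proof -
    have "(1 - ?X ^ (2 * (k + 1))) * pod_prefix (k + 1) = c * (1 + z * ?X)"
      using pod_prefix_Suc[of k] by (simp add: c_def z_def mult.commute)
    moreover have "?X ^ (2 * (k + 1) * r) = y * v"
      unfolding y_def v_def power_add[symmetric] by (rule arg_cong[of _ _ "power fps_X"]) simp
    moreover have "k + 1 + r = k + r + 1" "k + r + 1 + 1 = k + r + 2" by simp_all
    ultimately show ?thesis
      unfolding remainder_term_def h_def e_def by (simp only:)
  qed
  have t3: "telescoper k r = (1 - z * z * v * ?X\<^sup>2) * c * y * g * ((1 + z * v * ?X ^ 3) * h * e)"
  proof -
    have "?X ^ (2 * (2 * k + r + 1)) = z * z * v * ?X\<^sup>2"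
      unfolding z_def v_def power_add[symmetric] by (rule arg_cong[of _ _ "power fps_X"]) simp
    then show ?thesis unfolding telescoper_def tail c_def y_def g_def by (simp only:)
  qed
  have t4: "telescoper k (r + 1) = (1 - z * z * v * ?X ^ 4) * c * (y * z) * h * e"
  proof -
    have "?X ^ (2 * (2 * k + (r + 1) + 1)) = z * z * v * ?X ^ 4"
      unfolding z_def v_def power_add[symmetric] by (rule arg_cong[of _ _ "power fps_X"]) simp
    moreover have "?X ^ (2 * k * (r + 1)) = y * z"
      unfolding z_def y_def power_add[symmetric] by (rule arg_cong[of _ _ "power fps_X"]) simp
    moreover have "k + (r + 1) = k + r + 1" "k + r + 1 + 1 = k + r + 2" by simp_all
    ultimately show ?thesis unfolding telescoper_def c_def h_def e_def by (simp only:)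
  qed
  have pw: "?X ^ (4 * k + 3) = z * z * ?X ^ 3"
    unfolding z_def power_add[symmetric] by (rule arg_cong[of _ _ "power fps_X"]) simp
  have poly: "(1 - z) * (1 + z * v * ?X ^ 3) + z * z * ?X ^ 3 * (1 + z * ?X) * v * (1 - z * v * ?X\<^sup>2)
     = (1 - z * z * v * ?X\<^sup>2) * (1 + z * v * ?X ^ 3) - (1 - z * z * v * ?X ^ 4) * z * (1 - z * v * ?X\<^sup>2)"
    by algebra
  have "remainder_term k r + fps_X ^ (4 * k + 3) * remainder_term (k + 1) r
     = (1 - z) * c * y * g * ((1 + z * v * ?X ^ 3) * h * e)
       + z * z * ?X ^ 3 * ((c * (1 + z * ?X)) * (y * v) * h * e) * ((1 - z * v * ?X\<^sup>2) * g)"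
    unfolding t1 t2 pw gd by simp
  also have "\<dots> = ((1 - z) * (1 + z * v * ?X ^ 3) + z * z * ?X ^ 3 * (1 + z * ?X) * v * (1 - z * v * ?X\<^sup>2)) * (c * y * g * h * e)"
    by (simp only: ring_distribs mult_ac)
  also have "\<dots> = (1 - z * z * v * ?X\<^sup>2) * c * y * g * ((1 + z * v * ?X ^ 3) * h * e)
       - (1 - z * z * v * ?X ^ 4) * c * (y * z) * h * e * ((1 - z * v * ?X\<^sup>2) * g)"
    unfolding poly by algebra
  also have "\<dots> = telescoper k r - telescoper k (r + 1)"
    unfolding t3 t4 gd by simp
  finally show ?thesis .
qed

lemma telescoper_0: "telescoper k 0 = (1 - fps_X ^ (2 * k + 1)) * pod_series"
proof -
  let ?g = "inverse (1 - fps_X ^ (2 * k + 2)) :: real fps"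
  have sq: "fps_X ^ (2 * (2 * k + 0 + 1)) = (fps_X ^ (2 * k + 1) :: real fps)\<^sup>2"
    unfolding power_mult[symmetric] by (rule arg_cong[of _ _ "power fps_X"]) simp
  have "pod_series = pod_prefix k * ((1 + fps_X ^ (2 * k + 1)) * ?g * pod_tail (k + 1))"
    using pod_prefix_mult_tail[of k] pod_tail_step[of k] by (simp add: pod_factor_def)
  moreover have "(1 - w\<^sup>2) * c * 1 * g * e = (1 - w) * p" if "p = c * ((1 + w) * g * e)"
    for w c g e p :: "real fps"
    unfolding that by algebra
  moreover have "fps_X ^ (2 * k * 0) = (1 :: real fps)" "k + 0 = k" by simp_all
  ultimately show ?thesis
    unfolding telescoper_def sq by presburger
qed

definition remainder_series :: "nat \<Rightarrow> nat \<Rightarrow> real fps" where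
  "remainder_series k R = (\<Sum>r<R. remainder_term k r)"

text \<open>The partial theta function \<open>H\<^sub>k = \<Sum>\<^sub>j z\<^sup>j (-q)\<^bsup>j(j+1)/2\<^esup>\<close> with \<open>z = q\<^bsup>2k\<^esup>\<close> satisfies
  \<open>H\<^sub>k = 1 - q\<^bsup>2k+1\<^esup> - q\<^bsup>4k+3\<^esup> H\<^bsub>k+1\<^esub>\<close> by splitting off its first two terms.  This is the same
  recurrence for \<open>D H\<^sub>k\<close>, up to a boundary term that is small for large \<open>R\<close> if \<open>k > 0\<close>.\<close>

lemma remainder_recurrence:
  "remainder_series k R + fps_X ^ (4 * k + 3) * remainder_series (k + 1) R
     = (1 - fps_X ^ (2 * k + 1)) * pod_series - telescoper k R"
proof -
  have "remainder_series k R + fps_X ^ (4 * k + 3) * remainder_series (k + 1) R =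
     (\<Sum>r<R. telescoper k r - telescoper k (Suc r))"
    using telescoping_step[of k]
    by (simp add: remainder_series_def sum_distrib_left flip: sum.distrib)
  also have "\<dots> = telescoper k 0 - telescoper k R"
    by (rule sum_lessThan_telescope')
  finally show ?thesis by (simp only: telescoper_0)
qed

lemma telescoper_small: "k > 0 \<Longrightarrow> fps_X ^ R dvd telescoper k R"
proof -
  assume "k > 0"
  then have "R \<le> 2 * k * R" by simp
  then have "fps_X ^ R dvd (fps_X ^ (2 * k * R) :: real fps)" by (rule le_imp_power_dvd)
  then show ?thesis unfolding telescoper_def by (intro dvd_mult2 dvd_mult)
qed

text \<open>The boundary term that does not vanish: for \<open>k = 0\<close> the remainder is \<open>0\<close> and the telescoper tends
  to \<open>1\<close>, which is how the constant \<open>1\<close> of Gauss's identity arises.\<close>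

lemma telescoper_zero_near_1: "fps_X ^ R dvd telescoper 0 R - 1"
proof -
  have "(1 - fps_X ^ (2 * R + 2)) * inverse (1 - fps_X ^ (2 * R + 2)) = (1 :: real fps)"
    by (rule inverse_one_minus_X_power) simp
  then have "telescoper 0 R = pod_tail (R + 1)"
    by (simp add: telescoper_def pod_prefix_def)
  moreover have "fps_X ^ R dvd (fps_X ^ (R + 1) :: real fps)" by (rule le_imp_power_dvd) simp
  ultimately show ?thesis using pod_tail_near_1[of "R + 1"] dvd_trans by metis
qed

text \<open>This form shows the nonnegativity: the last denominator of \<open>pod_prefix (Suc k)\<close> is gone, and no
  minus sign is left outside the geometric series.\<close>

lemma remainder_term_Suc:
  "remainder_term (Suc k) r = pod_prefix k * (1 + fps_X ^ (2 * k + 1)) * fps_X ^ (2 * Suc k * r) *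
     inverse (1 - fps_X ^ (2 * (Suc k + r) + 2)) * pod_tail (Suc k + r + 1)"
  unfolding remainder_term_def pod_prefix_Suc ..

lemma remainder_series_zero: "remainder_series 0 R = 0"
  by (simp add: remainder_series_def remainder_term_def)

lemma nonneg_remainder_term: "nonneg_series (remainder_term (Suc k) r)"
  unfolding remainder_term_Suc pod_prefix_def
  by (intro nonneg_series_mult nonneg_series_add nonneg_series_1 nonneg_series_X_power
      nonneg_series_geometric nonneg_series_prod nonneg_series_pod_factor nonneg_series_pod_tail) simp

lemma pod_tail_nth_0: "pod_tail (Suc k) $ 0 = 1"
  using fps_X_power_dvd_nth[OF pod_tail_near_1[of "Suc k"], of 0] by simp

text \<open>A nonnegative series stays at least as large when multiplied by a nonnegative series with
  constant term \<open>1\<close>, so it is enough to find a summand with a factor that has a positive coefficient in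
  degree \<open>m\<close> and a cofactor of this kind.\<close>

lemma remainder_positive:
  assumes "k > 0" "m < R"
  shows "remainder_series k R $ m > 0"
proof -
  obtain j where k: "k = Suc j" using assms by (cases k) auto
  have nonneg: "nonneg_series (remainder_term k r)" for r
    unfolding k by (rule nonneg_remainder_term)
  show ?thesis
  proof (cases j)
    case 0
    \<comment> \<open>For \<open>k = 1\<close> the exponents \<open>2r\<close> of the summands and the factor \<open>1 + q\<close> together reach every degree.\<close>
    have ge: "((1 + fps_X) * fps_X ^ (2 * r)) $ m \<le> remainder_term k r $ m" for r
    proof -
      have "remainder_term k r = ((1 + fps_X) * fps_X ^ (2 * r)) *
         (inverse (1 - fps_X ^ (2 * (Suc 0 + r) + 2)) * pod_tail (Suc 0 + r + 1))"
        unfolding k 0 remainder_term_Suc by (simp add: pod_prefix_def mult.assoc)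
      moreover have "nonneg_series ((1 + fps_X) * fps_X ^ (2 * r))"
        using nonneg_series_X_power[of 1]
        by (intro nonneg_series_mult nonneg_series_add nonneg_series_1 nonneg_series_X_power) simp
      moreover have "nonneg_series (inverse (1 - fps_X ^ (2 * (Suc 0 + r) + 2)) * pod_tail (Suc 0 + r + 1))"
        by (intro nonneg_series_mult nonneg_series_geometric nonneg_series_pod_tail) simp
      ultimately show ?thesis
        using nonneg_series_mult_ge pod_tail_nth_0[of "Suc 0 + r"] by simp
    qed
    have "((1 + fps_X) * fps_X ^ (2 * (m div 2))) $ m = (1 :: real)"
      by (cases "even m") (auto simp: distrib_right fps_X_power_nth simp flip: power_Suc elim!: oddE evenE)
    then have "0 < remainder_term k (m div 2) $ m" using ge[of "m div 2"] by simp
    also have "\<dots> \<le> (\<Sum>r<R. remainder_term k r $ m)"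
      using nonneg assms by (intro member_le_sum) (auto simp: nonneg_series_def)
    finally show ?thesis by (simp add: remainder_series_def fps_sum_nth)
  next
    case (Suc i)
    \<comment> \<open>For \<open>k > 1\<close> the first summand contains \<open>(1 + q)/(1 - q\<^sup>2) = 1/(1 - q)\<close>, all of whose coefficients are \<open>1\<close>.\<close>
    define f where "f = (\<Prod>a\<in>{1..<Suc i}. pod_factor a) * (1 + fps_X ^ (2 * j + 1)) *
      (inverse (1 - fps_X ^ (2 * (Suc j + 0) + 2)) * pod_tail (Suc j + 0 + 1))"
    have "nonneg_series f"
      unfolding f_def
      by (intro nonneg_series_mult nonneg_series_add nonneg_series_1 nonneg_series_X_power
          nonneg_series_geometric nonneg_series_prod nonneg_series_pod_factor nonneg_series_pod_tail) simp
    moreover have "f $ 0 = 1"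
    proof -
      have "(\<Prod>a\<in>{1..<Suc i}. pod_factor a) $ 0 = 1"
        by (induction i) (simp_all add: prod.atLeastLessThan_Suc)
      then show ?thesis using pod_tail_nth_0[of "Suc j"] by (simp add: f_def)
    qed
    moreover have "remainder_term k 0 = pod_factor 0 * f"
    proof -
      have "pod_prefix j = pod_factor 0 * (\<Prod>a\<in>{1..<Suc i}. pod_factor a)"
        unfolding pod_prefix_def Suc lessThan_atLeast0 by (simp add: prod.atLeast_Suc_lessThan)
      then show ?thesis unfolding k remainder_term_Suc f_def by (simp add: mult.assoc)
    qed
    ultimately have "pod_factor 0 $ m \<le> remainder_term k 0 $ m"
      using nonneg_series_mult_ge[OF nonneg_series_pod_factor] by simp
    moreover have "pod_factor 0 $ m = 1"
    proof -
      have "(1 + fps_X) * multiplicity_series UNIV 2 = Abs_fps (\<lambda>n. 1)"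
        by (rule fps_ext) (auto simp: distrib_right multiplicity_series_def)
      then show ?thesis by (simp add: pod_factor_def multiplicity_series_UNIV numeral_2_eq_2)
    qed
    ultimately have "0 < remainder_term k 0 $ m" by simp
    also have "\<dots> \<le> (\<Sum>r<R. remainder_term k r $ m)"
      using nonneg assms by (intro member_le_sum) (auto simp: nonneg_series_def)
    finally show ?thesis by (simp add: remainder_series_def fps_sum_nth)
  qed
qed

definition truncated_theta :: "nat \<Rightarrow> real fps" where
  "truncated_theta k = (\<Sum>j<2 * k. (-1) ^ (j * (j + 1) div 2) * fps_X ^ (j * (j + 1) div 2))"

lemma truncated_theta_Suc:
  "truncated_theta (Suc k) = truncated_theta k + (-1) ^ k * fps_X ^ (k * (2 * k + 1)) * (1 - fps_X ^ (2 * k + 1))"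
proof -
  have e: "2 * k * (2 * k + 1) div 2 = k * (2 * k + 1)" by simp
  have "(2 * k + 1) * (2 * k + 1 + 1) = 2 * ((2 * k + 1) * (k + 1))" by simp
  then have o: "(2 * k + 1) * (2 * k + 1 + 1) div 2 = k * (2 * k + 1) + (2 * k + 1)"
    by (simp only: nonzero_mult_div_cancel_left) simp
  have "(-1 :: real fps) ^ (k * (2 * k + 1)) = ((-1) ^ (2 * k + 1)) ^ k"
    unfolding mult.commute[of k] power_mult ..
  then have s: "(-1 :: real fps) ^ (k * (2 * k + 1)) = (-1) ^ k" by simp
  have two: "2 * Suc k = Suc (Suc (2 * k))" by simp
  have "truncated_theta (Suc k) = truncated_theta k + (-1) ^ (2 * k * (2 * k + 1) div 2) * fps_X ^ (2 * k * (2 * k + 1) div 2)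
     + (-1) ^ ((2 * k + 1) * (2 * k + 1 + 1) div 2) * fps_X ^ ((2 * k + 1) * (2 * k + 1 + 1) div 2)"
    unfolding truncated_theta_def two sum.lessThan_Suc by (simp only: Suc_eq_plus1)
  also have "\<dots> = truncated_theta k + (-1) ^ k * fps_X ^ (k * (2 * k + 1)) * (1 - fps_X ^ (2 * k + 1))"
    unfolding e o power_add s by (simp add: algebra_simps)
  finally show ?thesis .
qed

text \<open>Going from \<open>k\<close> to \<open>k + 1\<close> adds two terms to the theta sum, and these are accounted for by the
  recurrence of the remainders.  The terms omitted from the infinite sum over \<open>r\<close> only affect degrees
  from \<open>R\<close> on.\<close>

lemma truncated_gauss_identity:
  assumes "k > 0"
  shows "fps_X ^ R dvd (1 - truncated_theta k * pod_series)
           - (-1) ^ k * fps_X ^ (k * (2 * k + 1)) * remainder_series k R"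
  using assms
proof (induction k rule: nat_induct_non_zero)
  case 1
  have th: "truncated_theta 1 = 1 - fps_X" using truncated_theta_Suc[of 0] by (simp add: truncated_theta_def)
  have "fps_X ^ 3 * remainder_series 1 R = (1 - fps_X) * pod_series - telescoper 0 R"
    using remainder_recurrence[of 0 R] by (simp add: remainder_series_zero)
  then have "(1 - truncated_theta 1 * pod_series) - (-1) ^ 1 * fps_X ^ (1 * (2 * 1 + 1)) * remainder_series 1 R
      = - (telescoper 0 R - 1)"
    unfolding th by simp
  then show ?case using telescoper_zero_near_1[of R] by (simp only: dvd_minus_iff)
next
  case (Suc k)
  let ?s = "(-1) ^ k * fps_X ^ (k * (2 * k + 1)) :: real fps"
  have exp: "Suc k * (2 * Suc k + 1) = k * (2 * k + 1) + (4 * k + 3)" by simp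
  have s': "(-1) ^ Suc k * fps_X ^ (Suc k * (2 * Suc k + 1)) = - (?s * fps_X ^ (4 * k + 3))"
    unfolding exp power_add by simp
  have rec: "fps_X ^ (4 * k + 3) * remainder_series (Suc k) R =
      (1 - fps_X ^ (2 * k + 1)) * pod_series - telescoper k R - remainder_series k R"
    using remainder_recurrence[of k R] by (simp add: algebra_simps)
  have "(1 - truncated_theta (Suc k) * pod_series)
        - (-1) ^ Suc k * fps_X ^ (Suc k * (2 * Suc k + 1)) * remainder_series (Suc k) R
     = (1 - truncated_theta (Suc k) * pod_series)
        + ?s * (fps_X ^ (4 * k + 3) * remainder_series (Suc k) R)"
    unfolding s' by (simp add: mult.assoc)
  also have "\<dots> = (1 - truncated_theta k * pod_series) - ?s * remainder_series k R - ?s * telescoper k R"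
    unfolding rec truncated_theta_Suc by (simp add: ring_distribs mult_ac)
  finally have eq: "(1 - truncated_theta (Suc k) * pod_series)
        - (-1) ^ Suc k * fps_X ^ (Suc k * (2 * Suc k + 1)) * remainder_series (Suc k) R = \<dots>" .
  have "fps_X ^ R dvd ?s * telescoper k R"
    using telescoper_small[OF Suc.hyps, of R] by (rule dvd_mult)
  then show ?case unfolding eq by (rule dvd_diff[OF Suc.IH])
qed

lemma truncated_gauss_coefficients:
  assumes "k > 0"
  shows "((-1) ^ k * (1 - truncated_theta k * pod_series)) $ m \<ge> 0"
    and "((-1) ^ k * (1 - truncated_theta k * pod_series)) $ m > 0 \<longleftrightarrow> m \<ge> k * (2 * k + 1)"
proof -
  let ?T = "k * (2 * k + 1)" and ?R = "remainder_series k (Suc m)"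
  have "(-1 :: real fps) ^ k * (-1) ^ k = 1" by (simp flip: power_add mult_2)
  then have "(-1) ^ k * ((1 - truncated_theta k * pod_series) - (-1) ^ k * fps_X ^ ?T * ?R) =
     (-1) ^ k * (1 - truncated_theta k * pod_series) - fps_X ^ ?T * ?R"
    by (simp add: right_diff_distrib flip: mult.assoc)
  then have "fps_X ^ Suc m dvd (-1) ^ k * (1 - truncated_theta k * pod_series) - fps_X ^ ?T * ?R"
    using dvd_mult[OF truncated_gauss_identity[OF assms, of "Suc m"], of "(-1) ^ k"] by (simp only:)
  from fps_X_power_dvd_nth[OF this, of m]
  have "((-1) ^ k * (1 - truncated_theta k * pod_series)) $ m = (fps_X ^ ?T * ?R) $ m" by simp
  also have "\<dots> = (if m < ?T then 0 else ?R $ (m - ?T))"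
    by (simp add: fps_X_power_mult_nth)
  finally have "((-1) ^ k * (1 - truncated_theta k * pod_series)) $ m = (if m < ?T then 0 else ?R $ (m - ?T))" .
  moreover have "?R $ (m - ?T) > 0" by (rule remainder_positive[OF assms]) simp
  ultimately show "((-1) ^ k * (1 - truncated_theta k * pod_series)) $ m \<ge> 0"
    and "((-1) ^ k * (1 - truncated_theta k * pod_series)) $ m > 0 \<longleftrightarrow> m \<ge> ?T"
    by auto
qed

section \<open>From Gauss's identity to Q2\<close>

lemma truncated_theta_compose:
  "(truncated_theta k oo fps_X ^ 2) = (\<Sum>j = 0..<2 * k. (-1) ^ (j * (j + 1) div 2) * fps_X ^ (j * (j + 1)))"
proof -
  have X2: "(fps_X ^ 2 :: real fps) $ 0 = 0" by simp
  have neg: "(-1 :: real fps) oo fps_X ^ 2 = -1" by (simp add: fps_compose_uminus)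
  have sign_power: "((-1) ^ n * fps_X ^ n :: real fps) oo fps_X ^ 2 = (-1) ^ n * fps_X ^ (2 * n)" for n
    unfolding fps_compose_mult_distrib[OF X2] fps_compose_power[OF X2, symmetric] neg
    by (simp add: power_mult)
  have even: "2 * (j * (j + 1) div 2) = j * (j + 1)" for j :: nat by simp
  show ?thesis
    unfolding truncated_theta_def fps_compose_sum_distrib sign_power even by (simp add: atLeast0LessThan)
qed

text \<open>By the factorization of the generating function, the truncated sum over \<open>pod\<close> is the coefficient
  of \<open>Q(q) \<theta>\<^sub>k(q\<^sup>2) D(q\<^sup>2)\<close>, so \<open>Q(q)\<close> can be taken out of the difference.\<close>

lemma Q2_deviation:
  assumes "k > 0"
  shows "real_of_int ((-1) ^ k * (int (Q2 n) -
     (\<Sum>j = 0..2 * k - 1. (-1) ^ (j * (j + 1) div 2) * int (pod (int n - int (j * (j + 1))))))) =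
     (Q2_series * (((-1) ^ k * (1 - truncated_theta k * pod_series)) oo fps_X ^ 2)) $ n"
proof -
  have X2: "(fps_X ^ 2 :: real fps) $ 0 = 0" by simp
  have sgn: "((-1) ^ i :: real fps) = fps_const ((-1) ^ i)" for i
    by (simp flip: fps_const_power fps_const_neg)
  have pod: "real (pod (int n - int i)) = (fps_X ^ i * pod_series) $ n" for i
  proof -
    have "nat (int n - int i) = n - i" by simp
    then show ?thesis by (auto simp: fps_X_power_mult_nth pod_series_def pod_def)
  qed
  have neg: "(-1 :: real fps) ^ k oo fps_X ^ 2 = (-1) ^ k"
    unfolding fps_compose_power[OF X2, symmetric] by (simp add: fps_compose_uminus)
  have "Q2_series * (((-1) ^ k * (1 - truncated_theta k * pod_series)) oo fps_X ^ 2) =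
     (-1) ^ k * (Q2_series - (truncated_theta k oo fps_X ^ 2) * (Q2_series * (pod_series oo fps_X ^ 2)))"
    unfolding fps_compose_mult_distrib[OF X2] fps_compose_sub_distrib neg fps_compose_1
    by (simp only: right_diff_distrib mult_1_left mult_1_right mult_ac)
  also have "\<dots> = (-1) ^ k * (Q2_series - (truncated_theta k oo fps_X ^ 2) * pod_series)"
    unfolding pod_series_factorization[symmetric] ..
  also have "\<dots> $ n = (-1) ^ k * (real (Q2 n) -
      (\<Sum>j = 0..<2 * k. (-1) ^ (j * (j + 1) div 2) * real (pod (int n - int (j * (j + 1))))))"
    unfolding truncated_theta_compose sgn sum_distrib_right mult.assoc pod
    by (simp add: fps_sum_nth Q2_series_def)
  finally have "(Q2_series * (((-1) ^ k * (1 - truncated_theta k * pod_series)) oo fps_X ^ 2)) $ n = (-1) ^ k * (real (Q2 n) -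
      (\<Sum>j = 0..<2 * k. (-1) ^ (j * (j + 1) div 2) * real (pod (int n - int (j * (j + 1))))))" .
  moreover have "{0..<2 * k} = {0..2 * k - 1}" using assms by auto
  ultimately show ?thesis by (simp del: of_nat_mult of_nat_add)
qed

lemma Q2_parity_positive: "Q2 (n mod 2) > 0"
proof -
  let ?p = "replicate (n mod 2) (1 :: nat)"
  have "?p \<in> {p \<in> partitions (n mod 2). distinct p \<and> (\<forall>x\<in>set p. x mod 4 \<noteq> 2)}"
    by (cases "even n") (auto simp: partitions_def odd_iff_mod_2_eq_one even_iff_mod_2_eq_zero)
  then show ?thesis
    unfolding Q2_def using finite_partitions by (fastforce simp: card_gt_0_iff)
qed

theorem corollary4p4:
  fixes n k :: nat
  assumes "n > 0" and "k > 0"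
  shows "((-1) ^ k * (int (Q2 n) -
           (\<Sum>j = 0..2 * k - 1. (-1) ^ (j * (j + 1) div 2) * int (pod (int n - int (j * (j + 1)))))) \<ge> 0)
       \<and> ((-1) ^ k * (int (Q2 n) -
           (\<Sum>j = 0..2 * k - 1. (-1) ^ (j * (j + 1) div 2) * int (pod (int n - int (j * (j + 1)))))) > 0
         \<longleftrightarrow> n \<ge> 2 * k * (2 * k + 1))"
proof -
  let ?T = "k * (2 * k + 1)"
  define S where "S = (-1) ^ k * (1 - truncated_theta k * pod_series)"
  define d where "d = (-1) ^ k * (int (Q2 n) -
     (\<Sum>j = 0..2 * k - 1. (-1) ^ (j * (j + 1) div 2) * int (pod (int n - int (j * (j + 1))))))"
  have d: "real_of_int d = (\<Sum>i=0..n. Q2_series $ i * (S oo fps_X ^ 2) $ (n - i))"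
    unfolding d_def S_def Q2_deviation[OF assms(2)] fps_mult_nth ..
  have S0: "S $ m \<ge> 0" and Spos: "S $ m > 0 \<longleftrightarrow> m \<ge> ?T" for m
    unfolding S_def by (rule truncated_gauss_coefficients[OF assms(2)])+
  have Scomp: "(S oo fps_X ^ 2) $ m = (if even m then S $ (m div 2) else 0)" for m
    by (rule fps_compose_X_power_nth) simp
  have terms: "Q2_series $ i * (S oo fps_X ^ 2) $ (n - i) \<ge> 0" for i
    using S0 by (simp add: Scomp Q2_series_def)
  have "d \<ge> 0"
  proof -
    have "real_of_int d \<ge> 0" unfolding d by (rule sum_nonneg) (rule terms)
    then show ?thesis by simp
  qed
  moreover have "d > 0" if "n \<ge> 2 * k * (2 * k + 1)"
  proof -
    \<comment> \<open>Only even powers occur in \<open>S(q\<^sup>2)\<close>, so the index in \<open>Q(q)\<close> must have the parity of \<open>n\<close>.\<close>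
    let ?i = "n mod 2"
    have "Q2_series $ ?i > 0"
      using Q2_parity_positive by (simp add: Q2_series_def)
    moreover have "(n - ?i) div 2 \<ge> ?T"
    proof -
      have "(n - ?i) div 2 = n div 2" by presburger
      moreover have "2 * ?T \<le> n" using that by (simp add: mult.assoc)
      ultimately show ?thesis by linarith
    qed
    moreover have "even (n - ?i)" by presburger
    ultimately have "0 < Q2_series $ ?i * (S oo fps_X ^ 2) $ (n - ?i)"
      using Spos by (simp add: Scomp)
    also have "\<dots> \<le> (\<Sum>i=0..n. Q2_series $ i * (S oo fps_X ^ 2) $ (n - i))"
      using terms by (intro member_le_sum) auto
    finally show ?thesis using d by simp
  qed
  moreover have "n \<ge> 2 * k * (2 * k + 1)" if "d > 0"
  proof (rule ccontr)
    assume "\<not> n \<ge> 2 * k * (2 * k + 1)"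
    then have "n < 2 * ?T" by (simp add: mult.assoc)
    then have "(n - i) div 2 < ?T" for i by linarith
    then have "S $ ((n - i) div 2) = 0" for i
      using S0[of "(n - i) div 2"] Spos[of "(n - i) div 2"] by (metis leD le_less)
    then have "(S oo fps_X ^ 2) $ (n - i) = 0" for i by (simp add: Scomp)
    then have "real_of_int d = 0" unfolding d by simp
    then show False using that by simp
  qed
  ultimately show ?thesis unfolding d_def by blast
qed

end
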